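(* Let $a,b>2$ be integers with $a$ odd, and let $n=a+b-1$. Let $ET(n,a,b)$ be the graph with vertex set $V=\{v_1,\dots,v_n\}$ and edge set $E=\{e_1,\dots,e_{n+1}\}$, where $e_k$ joins $v_k$ and $v_{k+1}$ for $k=1,\dots,a-1$; $e_a$ joins $v_a$ and $v_1$; $e_k$ joins $v_{k-1}$ and $v_k$ for $k=a+1,\dots,n$; and $e_{n+1}$ joins $v_n$ and $v_a$. Let $W=BD^{-1}\in\mathbb{R}^{(n+1)\times n}$ be the weighted signless incidence matrix of $ET(n,a,b)$. Then, with the minimum taken over all real $n\times(n+1)$ matrices $G$ satisfying $WGW=W$, $$\min_{WGW=W}\|G\|_{\infty,\infty}=\begin{cases} a, & \text{if } b \text{ is odd and } a>2b,\\ 2\min\{a,b\}, & \text{if } b \text{ is odd and } a\leq 2b,\ b\leq 2a,\\ b, & \text{if } b \text{ is odd and } b>2a,\\ \max\{2a,a+b\}, & \text{if } b \text{ is even}.\end{cases}$$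
   Context: The edge-vertex incidence matrix $B=(b_{ij})$ of a graph with vertices $v_1,\dots,v_n$ and edges $e_1,\dots,e_m$ is the $m\times n$ matrix with $b_{ij}=1$ if $v_j$ is incident to $e_i$ and $b_{ij}=0$ otherwise; $D=\mathrm{diag}(d_1,\dots,d_n)$ where $d_i$ is the degree of $v_i$; the weighted signless incidence matrix is $W=BD^{-1}$. For a real matrix $A=(a_{ij})$, $\|A\|_{\infty,\infty}=\max\{\|AX\|_\infty:\|X\|_\infty=1\}=\max_i\sum_j|a_{ij}|$, where $\|x\|_\infty=\max_i|x_i|$. *)

theory Defs
  imports Complex_Main "Jordan_Normal_Form.Gauss_Jordan_Elimination"
begin

section \<open>Incidence matrices\<close>

text \<open>A graph with vertices \<open>1, \<dots>, n\<close> and edges \<open>1, \<dots>, m\<close> is given by \<open>n\<close>, \<open>m\<close> and the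
  function \<open>e\<close> that sends the number of an edge to its set of endpoints. Numbering starts from 1, while
  matrix indices start from 0; hence the \<open>Suc\<close> below.\<close>

definition incidence_mat :: "nat \<Rightarrow> nat \<Rightarrow> (nat \<Rightarrow> nat set) \<Rightarrow> real mat" where
  "incidence_mat n m e = mat m n (\<lambda>(i, j). if Suc j \<in> e (Suc i) then 1 else 0)"

definition vertex_degree :: "nat \<Rightarrow> (nat \<Rightarrow> nat set) \<Rightarrow> nat \<Rightarrow> nat" where
  "vertex_degree m e v = card {k \<in> {1..m}. v \<in> e k}"

definition degree_mat :: "nat \<Rightarrow> nat \<Rightarrow> (nat \<Rightarrow> nat set) \<Rightarrow> real mat" where
  "degree_mat n m e = mat_diag n (\<lambda>j. real (vertex_degree m e (Suc j)))"

text \<open>\<open>B D\<^sup>-\<^sup>1\<close>; meaningful only for graphs without isolated vertices, as otherwise \<open>D\<close> is singular.\<close>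

definition weighted_incidence_mat :: "nat \<Rightarrow> nat \<Rightarrow> (nat \<Rightarrow> nat set) \<Rightarrow> real mat" where
  "weighted_incidence_mat n m e = incidence_mat n m e * the (mat_inverse (degree_mat n m e))"

lemma mat_inverse_degree_mat:
  assumes pos: "\<And>v. v \<in> {1..n} \<Longrightarrow> vertex_degree m e v > 0"
  shows "mat_inverse (degree_mat n m e) = Some (mat_diag n (\<lambda>j. 1 / real (vertex_degree m e (Suc j))))"
proof -
  let ?D = "degree_mat n m e"
  let ?E = "mat_diag n (\<lambda>j. 1 / real (vertex_degree m e (Suc j)))"
  have D: "?D \<in> carrier_mat n n" and E: "?E \<in> carrier_mat n n"
    by (simp_all add: degree_mat_def)
  have nz: "vertex_degree m e (Suc j) \<noteq> 0" if "j < n" for j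
    using pos[of "Suc j"] that by simp
  have DE: "?D * ?E = 1\<^sub>m n" and ED: "?E * ?D = 1\<^sub>m n"
    unfolding degree_mat_def mat_diag_diag by (auto simp: mat_diag_def nz intro!: eq_matI)
  have "?D \<in> Units (ring_mat TYPE(real) n ())"
    unfolding Units_def ring_mat_def using D E DE ED by auto
  then obtain C where C: "mat_inverse ?D = Some C"
    using mat_inverse(1)[OF D, of "()"] by (cases "mat_inverse ?D") auto
  then have CD: "C * ?D = 1\<^sub>m n" and Cc: "C \<in> carrier_mat n n"
    using mat_inverse(2)[OF D] by blast+
  have "C = C * (?D * ?E)" using Cc DE by simp
  also have "\<dots> = ?E" using assoc_mult_mat[OF Cc D E] CD E by simp
  finally show ?thesis using C by simp
qed


section \<open>The graph \<open>ET(n, a, b)\<close>\<close>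

text \<open>An \<open>a\<close>-cycle and a \<open>b\<close>-cycle sharing exactly the vertex \<open>a\<close>.\<close>

definition ET_edge :: "nat \<Rightarrow> nat \<Rightarrow> nat \<Rightarrow> nat \<Rightarrow> nat set" where
  "ET_edge n a b k =
     (if k < a then {k, k + 1}
      else if k = a then {a, 1}
      else if k \<le> n then {k - 1, k}
      else {n, a})"

definition ET_W :: "nat \<Rightarrow> nat \<Rightarrow> nat \<Rightarrow> real mat" where
  "ET_W n a b = weighted_incidence_mat n (n + 1) (ET_edge n a b)"


section \<open>Norms and generalized inverses\<close>

definition inf_norm_vec :: "real vec \<Rightarrow> real" where
  "inf_norm_vec x = Max ((\<lambda>i. \<bar>x $ i\<bar>) ` {..<dim_vec x})"

text \<open>Here \<open>Sup\<close> is a maximum for matrices with at least one row and one column, and it equals the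
  largest absolute row sum; both are shown in \<open>inf_norm_mat_max\<close>.\<close>

definition inf_norm_mat :: "real mat \<Rightarrow> real" where
  "inf_norm_mat A =
     Sup {inf_norm_vec (A *\<^sub>v x) |x. x \<in> carrier_vec (dim_col A) \<and> inf_norm_vec x = 1}"

definition inner_inverses :: "real mat \<Rightarrow> real mat set" where
  "inner_inverses W = {G \<in> carrier_mat (dim_col W) (dim_row W). W * G * W = W}"

lemma inf_norm_vec_ge: "i < dim_vec x \<Longrightarrow> \<bar>x $ i\<bar> \<le> inf_norm_vec x"
  unfolding inf_norm_vec_def by (intro Max_ge) auto

lemma inf_norm_vec_le:
  "0 < dim_vec x \<Longrightarrow> (\<And>i. i < dim_vec x \<Longrightarrow> \<bar>x $ i\<bar> \<le> c) \<Longrightarrow> inf_norm_vec x \<le> c"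
  unfolding inf_norm_vec_def by (intro Max.boundedI) auto

lemma inf_norm_mat_max:
  fixes A :: "real mat"
  assumes A: "A \<in> carrier_mat m n" and m: "0 < m" and n: "0 < n"
  defines "R \<equiv> Max ((\<lambda>i. \<Sum>j<n. \<bar>A $$ (i, j)\<bar>) ` {..<m})"
  shows "inf_norm_mat A = R"
    and "\<exists>x \<in> carrier_vec n. inf_norm_vec x = 1 \<and> inf_norm_vec (A *\<^sub>v x) = inf_norm_mat A"
proof -
  let ?S = "{inf_norm_vec (A *\<^sub>v x) |x. x \<in> carrier_vec (dim_col A) \<and> inf_norm_vec x = 1}"
  have entry: "(A *\<^sub>v x) $ i = (\<Sum>j<n. A $$ (i, j) * x $ j)"
    if "x \<in> carrier_vec n" "i < m" for x i
    using that A by (auto simp: scalar_prod_def atLeast0LessThan intro!: sum.cong)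
  have dim: "dim_vec (A *\<^sub>v x) = m" for x
    using A by simp
  have upper: "inf_norm_vec (A *\<^sub>v x) \<le> R" if x: "x \<in> carrier_vec n" "inf_norm_vec x = 1" for x
  proof (rule inf_norm_vec_le)
    show "0 < dim_vec (A *\<^sub>v x)" using dim m by simp
    fix i assume "i < dim_vec (A *\<^sub>v x)"
    then have i: "i < m" using dim by simp
    have "\<bar>(A *\<^sub>v x) $ i\<bar> \<le> (\<Sum>j<n. \<bar>A $$ (i, j) * x $ j\<bar>)"
      unfolding entry[OF x(1) i] by (rule sum_abs)
    also have "\<dots> \<le> (\<Sum>j<n. \<bar>A $$ (i, j)\<bar>)"
      using inf_norm_vec_ge[of _ x] x by (intro sum_mono) (auto simp: abs_mult mult_left_le)
    also have "\<dots> \<le> R"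
      unfolding R_def using i by (intro Max_ge) auto
    finally show "\<bar>(A *\<^sub>v x) $ i\<bar> \<le> R" .
  qed
  have "R \<in> (\<lambda>i. \<Sum>j<n. \<bar>A $$ (i, j)\<bar>) ` {..<m}"
    unfolding R_def using m by (intro Max_in) auto
  then obtain i where i: "i < m" and Ri: "R = (\<Sum>j<n. \<bar>A $$ (i, j)\<bar>)"
    by auto
  define x where "x = vec n (\<lambda>j. if A $$ (i, j) < 0 then - 1 else 1 :: real)"
  have x: "x \<in> carrier_vec n" by (simp add: x_def)
  have absx: "\<bar>x $ j\<bar> = 1" if "j < n" for j
    using that by (simp add: x_def)
  have nx: "inf_norm_vec x = 1"
  proof (rule antisym)
    show "inf_norm_vec x \<le> 1" using x n absx by (intro inf_norm_vec_le) auto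
    show "1 \<le> inf_norm_vec x" using x n absx[of 0] inf_norm_vec_ge[of 0 x] by simp
  qed
  have "(A *\<^sub>v x) $ i = R"
    unfolding entry[OF x i] Ri by (intro sum.cong) (auto simp: x_def)
  then have "R \<le> inf_norm_vec (A *\<^sub>v x)"
    using inf_norm_vec_ge[of i "A *\<^sub>v x"] dim i by simp
  then have att: "inf_norm_vec (A *\<^sub>v x) = R"
    using upper[OF x nx] by simp
  have "R \<in> ?S" using att x nx A by auto
  moreover have "s \<le> R" if "s \<in> ?S" for s
    using that upper A by auto
  ultimately have "Sup ?S = R"
    by (intro cSup_eq_maximum) auto
  then show "inf_norm_mat A = R" by (simp add: inf_norm_mat_def)
  then show "\<exists>x \<in> carrier_vec n. inf_norm_vec x = 1 \<and> inf_norm_vec (A *\<^sub>v x) = inf_norm_mat A"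
    using att x nx by auto
qed

end

theory Submission
  imports Defs
begin

text \<open>Since \<open>a\<close> is odd, \<open>W\<close> has a left inverse, so \<open>WGW = W\<close> amounts to \<open>GW = I\<close>. Row \<open>i\<close> of such a
  \<open>G\<close> is an edge weighting whose sum over the edges at \<open>v\<close> is \<open>d\<^sub>i\<close> for \<open>v = v\<^sub>i\<close> and \<open>0\<close> otherwise; the
  rows can be minimized independently in the \<open>\<ell>\<^sub>1\<close> norm. By linear programming duality a lower bound
  for row \<open>i\<close> is \<open>d\<^sub>i \<bar>u\<^sub>i\<bar>\<close>, where \<open>u\<close> is any vertex weighting with \<open>\<bar>u\<^sub>p + u\<^sub>q\<bar> \<le> 1\<close> on every edge
  \<open>{p, q}\<close>. The extremal rows are the one of the common vertex of the cycles and the ones opposite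
  to it on either cycle. Writing weights as \<open>(-1)\<^sup>k c\<^sub>k\<close> turns the sum conditions into conditions on
  differences, except at the edges that close the odd cycles.\<close>

section \<open>Left inverses of weighted incidence matrices\<close>

lemma weighted_incidence_mat_eq:
  assumes pos: "\<forall>v\<in>{1..n}. vertex_degree m e v > 0"
  shows "weighted_incidence_mat n m e =
    mat m n (\<lambda>(k, j). if Suc j \<in> e (Suc k) then 1 / real (vertex_degree m e (Suc j)) else 0)"
proof -
  have B: "incidence_mat n m e \<in> carrier_mat m n"
    by (simp add: incidence_mat_def)
  have "mat_inverse (degree_mat n m e)
      = Some (mat_diag n (\<lambda>j. 1 / real (vertex_degree m e (Suc j))))"
    using pos by (intro mat_inverse_degree_mat) blast
  then show ?thesis
    unfolding weighted_incidence_mat_def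
    by (simp only: option.sel mat_diag_mult_right[OF B]) (auto simp: incidence_mat_def)
qed

lemma sum_shift_Suc: "(\<Sum>k<m. g (Suc k)) = (\<Sum>k\<in>{1..m}. g k)"
  by (rule sum.reindex_bij_witness[of _ "\<lambda>k. k - 1" Suc]) auto

lemma sum_shift_Suc_if: "(\<Sum>k<m. if P (Suc k) then g (Suc k) else 0) = (\<Sum>k | k \<in> {1..m} \<and> P k. g k)"
  unfolding sum_shift_Suc[of "\<lambda>k. if P k then g k else 0"]
  by (subst sum.inter_filter[symmetric]) (auto intro!: sum.cong)

text \<open>Row \<open>i\<close> of \<open>G * W\<close> depends only on row \<open>i\<close> of
  \<open>G\<close>, and the norm is the largest absolute row sum, so the rows can be chosen
  separately. Clearing the factor 1/degree from a column of \<open>W\<close> turns the diagonal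
  entry 1 into the degree.\<close>

lemma ex_left_inverse_of_rows:
  fixes e :: "nat \<Rightarrow> nat set" and \<mu> :: real
  assumes pos: "\<forall>v\<in>{1..n}. vertex_degree m e v > 0"
    and nm: "0 < n" "0 < m"
    and rows: "\<And>i. i \<in> {1..n} \<Longrightarrow> \<exists>f :: nat \<Rightarrow> real.
      (\<forall>v\<in>{1..n}. (\<Sum>k | k \<in> {1..m} \<and> v \<in> e k. f k)
         = (if v = i then real (vertex_degree m e i) else 0)) \<and>
      (\<Sum>k\<in>{1..m}. \<bar>f k\<bar>) \<le> \<mu>"
  shows "\<exists>G \<in> carrier_mat n m. G * weighted_incidence_mat n m e = 1\<^sub>m n \<and> inf_norm_mat G \<le> \<mu>"
proof -
  obtain f :: "nat \<Rightarrow> nat \<Rightarrow> real" where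
    f: "\<And>i v. i \<in> {1..n} \<Longrightarrow> v \<in> {1..n} \<Longrightarrow> (\<Sum>k | k \<in> {1..m} \<and> v \<in> e k. f i k)
         = (if v = i then real (vertex_degree m e i) else 0)"
    and norm: "\<And>i. i \<in> {1..n} \<Longrightarrow> (\<Sum>k\<in>{1..m}. \<bar>f i k\<bar>) \<le> \<mu>"
    using rows by metis
  define G where "G = mat n m (\<lambda>(i, k). f (Suc i) (Suc k))"
  have G: "G \<in> carrier_mat n m" by (simp add: G_def)
  have "G * weighted_incidence_mat n m e = 1\<^sub>m n"
  proof (rule eq_matI)
    fix i j assume "i < dim_row (1\<^sub>m n)" "j < dim_col (1\<^sub>m n)"
    then have ij: "i < n" "j < n" by auto
    let ?d = "real (vertex_degree m e (Suc j))"
    have "(G * weighted_incidence_mat n m e) $$ (i, j)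
        = (\<Sum>k<m. if Suc j \<in> e (Suc k) then f (Suc i) (Suc k) / ?d else 0)"
      unfolding weighted_incidence_mat_eq[OF pos] G_def using ij
      by (auto simp: scalar_prod_def atLeast0LessThan intro!: sum.cong)
    also have "\<dots> = (\<Sum>k | k \<in> {1..m} \<and> Suc j \<in> e k. f (Suc i) k) / ?d"
      by (simp only: sum_shift_Suc_if[of "\<lambda>k. Suc j \<in> e k" "\<lambda>k. f (Suc i) k / ?d"] sum_divide_distrib)
    also have "\<dots> = 1\<^sub>m n $$ (i, j)"
      using ij bspec[OF pos, of "Suc j"] f[of "Suc i" "Suc j"] by auto
    finally show "(G * weighted_incidence_mat n m e) $$ (i, j) = 1\<^sub>m n $$ (i, j)" .
  qed (auto simp: G_def weighted_incidence_mat_eq[OF pos])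
  moreover have "inf_norm_mat G \<le> \<mu>"
    unfolding inf_norm_mat_max(1)[OF G nm]
  proof (rule Max.boundedI)
    fix s assume "s \<in> (\<lambda>i. \<Sum>j<m. \<bar>G $$ (i, j)\<bar>) ` {..<n}"
    then obtain i where i: "i < n" and s: "s = (\<Sum>j<m. \<bar>G $$ (i, j)\<bar>)" by auto
    have "s = (\<Sum>k\<in>{1..m}. \<bar>f (Suc i) k\<bar>)"
      unfolding s sum_shift_Suc[symmetric] using i by (simp add: G_def)
    then show "s \<le> \<mu>" using norm[of "Suc i"] i by simp
  qed (use nm in auto)
  ultimately show ?thesis using G by blast
qed

text \<open>Weak duality: \<open>x\<close> scales \<open>u\<close> by the degrees, which cancels the
  division in \<open>W\<close>, so \<open>y\<close> lists the sums of \<open>u\<close> over the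
  edges and is bounded by 1. As \<open>G\<close> maps \<open>y\<close> to \<open>x\<close>, the
  entry of \<open>x\<close> at vertex \<open>i\<close> is at most an absolute row sum of
  \<open>G\<close>.\<close>

lemma dual_bound:
  fixes e :: "nat \<Rightarrow> nat set" and u :: "nat \<Rightarrow> real"
  assumes pos: "\<forall>v\<in>{1..n}. vertex_degree m e v > 0"
    and nm: "0 < n" "0 < m"
    and G: "G \<in> carrier_mat n m" and inv: "G * weighted_incidence_mat n m e = 1\<^sub>m n"
    and u: "\<And>k. k \<in> {1..m} \<Longrightarrow> \<bar>\<Sum>v | v \<in> {1..n} \<and> v \<in> e k. u v\<bar> \<le> 1"
    and i: "i \<in> {1..n}"
  shows "real (vertex_degree m e i) * u i \<le> inf_norm_mat G"
proof -
  let ?W = "weighted_incidence_mat n m e"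
  define x where "x = vec n (\<lambda>j. real (vertex_degree m e (Suc j)) * u (Suc j))"
  define y where "y = ?W *\<^sub>v x"
  have W: "?W \<in> carrier_mat m n" by (simp add: weighted_incidence_mat_eq[OF pos])
  have x: "x \<in> carrier_vec n" by (simp add: x_def)
  have y: "y \<in> carrier_vec m" unfolding y_def using W x by (rule mult_mat_vec_carrier)
  have y_le: "\<bar>y $ k\<bar> \<le> 1" if "k < m" for k
  proof -
    have "y $ k = (\<Sum>j<n. if Suc j \<in> e (Suc k) then u (Suc j) else 0)"
      unfolding y_def weighted_incidence_mat_eq[OF pos] x_def using that pos
      by (auto simp: scalar_prod_def atLeast0LessThan intro!: sum.cong)
    also have "\<dots> = (\<Sum>v | v \<in> {1..n} \<and> v \<in> e (Suc k). u v)"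
      by (rule sum_shift_Suc_if)
    finally show ?thesis using u[of "Suc k"] that by simp
  qed
  have Gy: "G *\<^sub>v y = x"
    unfolding y_def using inv assoc_mult_mat_vec[OF G W x] x by simp
  obtain i' where i': "i = Suc i'" "i' < n" using i by (cases i) auto
  have "real (vertex_degree m e i) * u i = (G *\<^sub>v y) $ i'"
    unfolding Gy using i' by (simp add: x_def)
  also have "\<dots> = (\<Sum>k<m. G $$ (i', k) * y $ k)"
    using G y i' by (auto simp: scalar_prod_def atLeast0LessThan intro!: sum.cong)
  also have "\<dots> \<le> (\<Sum>k<m. \<bar>G $$ (i', k)\<bar>)"
  proof (rule sum_mono)
    fix k assume "k \<in> {..<m}"
    then have "\<bar>G $$ (i', k) * y $ k\<bar> \<le> \<bar>G $$ (i', k)\<bar>"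
      using y_le[of k] by (simp add: abs_mult mult_left_le)
    then show "G $$ (i', k) * y $ k \<le> \<bar>G $$ (i', k)\<bar>" by linarith
  qed
  also have "\<dots> \<le> inf_norm_mat G"
    unfolding inf_norm_mat_max(1)[OF G nm] using i' by (intro Max_ge) auto
  finally show ?thesis .
qed

text \<open>Multiplying \<open>W * G * W = W\<close> by \<open>L\<close> on the left cancels the
  first \<open>W\<close>.\<close>

lemma inner_inverses_eq_left_inverses:
  assumes W: "W \<in> carrier_mat m n" and L: "L \<in> carrier_mat n m" and LW: "L * W = 1\<^sub>m n"
  shows "inner_inverses W = {G \<in> carrier_mat n m. G * W = 1\<^sub>m n}"
proof -
  have "G * W = 1\<^sub>m n \<longleftrightarrow> W * G * W = W" if G: "G \<in> carrier_mat n m" for G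
  proof
    assume "G * W = 1\<^sub>m n"
    then show "W * G * W = W" using assoc_mult_mat[OF W G W] W by simp
  next
    assume *: "W * G * W = W"
    have GW: "G * W \<in> carrier_mat n n" using G W by simp
    have "G * W = L * W * (G * W)" using left_mult_one_mat[OF GW] LW by metis
    also have "\<dots> = L * (W * G * W)"
      using assoc_mult_mat[OF L W GW] assoc_mult_mat[OF W G W] by simp
    also have "\<dots> = 1\<^sub>m n" using * LW by simp
    finally show "G * W = 1\<^sub>m n" .
  qed
  then show ?thesis using W unfolding inner_inverses_def by auto
qed

section \<open>The two cycles\<close>

locale ET =
  fixes a b n :: nat
  assumes a: "a > 2" and b: "b > 2" and odd_a: "odd a" and n: "n = a + b - 1"
begin

lemma n1: "n + 1 = a + b"
  using a n by simp

abbreviation "edge \<equiv> ET_edge n a b"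

text \<open>Edge \<open>a\<close> closes the first cycle, so on the second one edge numbers run one
  ahead: vertex \<open>v > a\<close> lies on edges \<open>v\<close> and
  \<open>v + 1\<close>.\<close>

lemma edges_at:
  assumes "v \<in> {1..n}"
  shows "{k. k \<in> {1..n + 1} \<and> v \<in> edge k} =
    (if v = 1 then {1, a} else if v < a then {v - 1, v} else if v = a then {a - 1, a, a + 1, n + 1}
     else {v, v + 1})"
  using assms a b n by (auto simp: ET_edge_def split: if_splits)

lemma degree:
  assumes "v \<in> {1..n}"
  shows "vertex_degree (n + 1) edge v = (if v = a then 4 else 2)"
proof -
  obtain k where "a = Suc k" using a by (cases a) auto
  then show ?thesis
    unfolding vertex_degree_def edges_at[OF assms] using a b n assms by (auto simp: card_insert_if)
qed

lemma degree_pos: "\<forall>v\<in>{1..n}. vertex_degree (n + 1) edge v > 0"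
  by (metis degree zero_less_numeral)

section \<open>Signed edge weightings as candidate rows\<close>

lemma sum_edges_at:
  fixes c :: "nat \<Rightarrow> real"
  assumes "v \<in> {1..n}"
  shows "(\<Sum>k | k \<in> {1..n + 1} \<and> v \<in> edge k. (-1) ^ k * c k) =
    (if v = 1 then - c 1 - c a
     else if v < a then (-1) ^ v * (c v - c (v - 1))
     else if v = a then c (a - 1) - c a + c (a + 1) - (- 1) ^ b * c (n + 1)
     else (-1) ^ v * (c v - c (v + 1)))"
proof -
  \<comment> \<open>The signs at the common vertex: \<open>a - 1\<close> and \<open>a + 1\<close>
    are even, \<open>a\<close> is odd, and the last edge \<open>a + b\<close> has parity opposite to
    \<open>b\<close>.\<close>
  have "even (a - 1)" "a - 1 \<notin> {a, a + 1, a + b}" using odd_a a by auto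
  moreover have "(-1 :: real) ^ v = - ((-1) ^ (v - 1))" if "v > 0"
    using that by (cases v) auto
  ultimately show ?thesis
    unfolding edges_at[OF assms] unfolding n1 using a b assms odd_a
    by (auto simp: algebra_simps power_add)
qed

definition row_norm_le :: "nat \<Rightarrow> real \<Rightarrow> bool" where
  "row_norm_le i \<mu> \<longleftrightarrow> (\<exists>f :: nat \<Rightarrow> real.
      (\<forall>v\<in>{1..n}. (\<Sum>k | k \<in> {1..n + 1} \<and> v \<in> edge k. f k)
         = (if v = i then real (vertex_degree (n + 1) edge i) else 0)) \<and>
      (\<Sum>k\<in>{1..n + 1}. \<bar>f k\<bar>) \<le> \<mu>)"

text \<open>The row is \<open>(-1) ^ k * c k\<close>. The sign does not change absolute values, and
  the factor \<open>(-1) ^ i\<close> in the jump at \<open>i\<close> cancels the sign in front of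
  the difference there.\<close>

lemma ex_row_of_signed_weights:
  fixes c :: "nat \<Rightarrow> real"
  assumes i: "i \<in> {1..n}"
    and at_1: "- c 1 - c a = (if i = 1 then 2 else 0)"
    and at_a_cycle: "\<And>v. 1 < v \<Longrightarrow> v < a \<Longrightarrow> c v - c (v - 1) = (if v = i then 2 * (-1) ^ i else 0)"
    and at_a: "c (a - 1) - c a + c (a + 1) - (- 1) ^ b * c (a + b) = (if i = a then 4 else 0)"
    and at_b_cycle: "\<And>v. a < v \<Longrightarrow> v < a + b \<Longrightarrow> c v - c (v + 1) = (if v = i then 2 * (-1) ^ i else 0)"
    and norm: "(\<Sum>k\<in>{1..a}. \<bar>c k\<bar>) + (\<Sum>k\<in>{a<..a + b}. \<bar>c k\<bar>) \<le> \<mu>"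
  shows "row_norm_le i \<mu>"
  unfolding row_norm_le_def
proof (intro exI[of _ "\<lambda>k. (-1) ^ k * c k"] conjI ballI)
  fix v assume v: "v \<in> {1..n}"
  have sgn: "(-1 :: real) ^ i * (2 * (-1) ^ i) = 2"
    by (simp flip: power_add mult.assoc add: mult.commute[of _ 2])
  show "(\<Sum>k | k \<in> {1..n + 1} \<and> v \<in> edge k. (-1) ^ k * c k)
      = (if v = i then real (vertex_degree (n + 1) edge i) else 0)"
    unfolding sum_edges_at[OF v] degree[OF i]
    using at_1 at_a_cycle[of v] at_a at_b_cycle[of v] v a n1 sgn by (auto simp: n1)
next
  have "{1..n + 1} = {1..a} \<union> {a<..a + b}" using a n by auto
  then have "(\<Sum>k\<in>{1..n + 1}. \<bar>c k\<bar>) = (\<Sum>k\<in>{1..a}. \<bar>c k\<bar>) + (\<Sum>k\<in>{a<..a + b}. \<bar>c k\<bar>)"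
    by (simp only:) (subst sum.union_disjoint; auto)
  with norm show "(\<Sum>k\<in>{1..n + 1}. \<bar>(-1) ^ k * c k\<bar>) \<le> \<mu>"
    by (simp add: abs_mult power_abs)
qed

section \<open>Signed vertex weightings and the dual bound\<close>

lemma sum_vertices_on:
  fixes c :: "nat \<Rightarrow> real"
  assumes "k \<in> {1..n + 1}"
  shows "(\<Sum>v | v \<in> {1..n} \<and> v \<in> edge k. (-1) ^ v * c v) =
    (if k < a then (-1) ^ k * (c k - c (k + 1))
     else if k = a then - c a - c 1
     else if k \<le> n then (-1) ^ k * (c k - c (k - 1))
     else (-1) ^ b * c n - c a)"
proof -
  have "{v. v \<in> {1..n} \<and> v \<in> edge k} =
    (if k < a then {k, k + 1} else if k = a then {a, 1} else if k \<le> n then {k - 1, k} else {n, a})"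
    using assms a b n by (auto simp: ET_edge_def)
  moreover have "(-1 :: real) ^ k = - ((-1) ^ (k - 1))"
    using assms by (cases k) auto
  \<comment> \<open>\<open>n\<close> and \<open>b\<close> differ by the even number
    \<open>a - 1\<close>.\<close>
  moreover have "(-1 :: real) ^ n = (-1) ^ b"
    using a b n odd_a by (cases b) (auto simp: power_add)
  ultimately show ?thesis
    using a b assms odd_a n by (auto simp: algebra_simps)
qed

lemma signed_dual_bound:
  fixes c :: "nat \<Rightarrow> real"
  assumes G: "G \<in> carrier_mat n (n + 1)" and inv: "G * ET_W n a b = 1\<^sub>m n"
    and i: "i \<in> {1..n}"
    and lipschitz: "\<And>k. 1 \<le> k \<Longrightarrow> k < n \<Longrightarrow> \<bar>c (k + 1) - c k\<bar> \<le> 1"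
    and closing: "\<bar>c a + c 1\<bar> \<le> 1" "\<bar>c a - (-1) ^ b * c n\<bar> \<le> 1"
  shows "(if i = a then 4 else 2) * \<bar>c i\<bar> \<le> inf_norm_mat G"
proof -
  have sum: "\<bar>\<Sum>v | v \<in> {1..n} \<and> v \<in> edge k. (-1) ^ v * c v\<bar> \<le> 1" if k: "k \<in> {1..n + 1}" for k
    unfolding sum_vertices_on[OF k]
    using lipschitz[of k] lipschitz[of "k - 1"] closing a b n k
    by (auto simp: abs_mult power_abs abs_minus_commute)
  \<comment> \<open>A feasible weighting remains feasible when negated; using both signs yields the
    absolute value.\<close>
  have *: "(if i = a then 4 else 2) * (s * ((-1) ^ i * c i)) \<le> inf_norm_mat G" if s: "\<bar>s\<bar> = 1" for s
  proof -
    have "\<bar>\<Sum>v | v \<in> {1..n} \<and> v \<in> edge k. s * ((-1) ^ v * c v)\<bar> \<le> 1" if k: "k \<in> {1..n + 1}" for k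
      unfolding sum_distrib_left[symmetric] abs_mult s using sum[OF k] by simp
    from dual_bound[OF degree_pos _ _ G inv[unfolded ET_W_def] this i] show ?thesis
      using a n degree[OF i] by (auto split: if_splits)
  qed
  show ?thesis
    using *[of 1] *[of "- 1"] by (cases "even i") (auto simp: abs_if split: if_splits)
qed

text \<open>Dual weightings are built cycle by cycle: \<open>p k\<close> belongs to vertex
  \<open>k\<close> and \<open>q j\<close> to vertex \<open>a + j\<close>, and they are glued at the
  common vertex by \<open>p a = q 0\<close>.\<close>

lemma cycle_dual_bounds:
  fixes p q :: "nat \<Rightarrow> real"
  assumes G: "G \<in> carrier_mat n (n + 1)" and inv: "G * ET_W n a b = 1\<^sub>m n"
    and pq: "p a = q 0"
    and p: "\<And>k. 1 \<le> k \<Longrightarrow> k < a \<Longrightarrow> \<bar>p (k + 1) - p k\<bar> \<le> 1" "\<bar>p a + p 1\<bar> \<le> 1"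
    and q: "\<And>j. j < b - 1 \<Longrightarrow> \<bar>q (j + 1) - q j\<bar> \<le> 1" "\<bar>q 0 - (-1) ^ b * q (b - 1)\<bar> \<le> 1"
  shows "4 * \<bar>p a\<bar> \<le> inf_norm_mat G"
    and "\<And>i. 1 \<le> i \<Longrightarrow> i < a \<Longrightarrow> 2 * \<bar>p i\<bar> \<le> inf_norm_mat G"
    and "\<And>j. 1 \<le> j \<Longrightarrow> j < b \<Longrightarrow> 2 * \<bar>q j\<bar> \<le> inf_norm_mat G"
proof -
  define c where "c k = (if k \<le> a then p k else q (k - a))" for k
  have lipschitz: "\<bar>c (k + 1) - c k\<bar> \<le> 1" if k: "1 \<le> k" "k < n" for k
  proof (cases "k < a")
    case True
    then show ?thesis using p(1)[of k] k by (simp add: c_def)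
  next
    case False
    then show ?thesis using q(1)[of "k - a"] k pq n by (auto simp: c_def Suc_diff_le)
  qed
  have closing: "\<bar>c a + c 1\<bar> \<le> 1" "\<bar>c a - (-1) ^ b * c n\<bar> \<le> 1"
    using p(2) q(2) pq a b n by (auto simp: c_def)
  note bound = signed_dual_bound[OF G inv _ lipschitz closing]
  show "4 * \<bar>p a\<bar> \<le> inf_norm_mat G"
    using bound[of a] a b n by (simp add: c_def)
  show "2 * \<bar>p i\<bar> \<le> inf_norm_mat G" if "1 \<le> i" "i < a" for i
    using bound[of i] that n by (simp add: c_def)
  show "2 * \<bar>q j\<bar> \<le> inf_norm_mat G" if "1 \<le> j" "j < b" for j
    using bound[of "a + j"] that n by (simp add: c_def)
qed

text \<open>Interpolating linearly between \<open>-h\<close> and \<open>h\<close> along an odd cycle of length \<open>l\<close> is dual feasible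
  as long as the step \<open>2h / l\<close> is at most 1.\<close>

definition ramp_a :: "real \<Rightarrow> nat \<Rightarrow> real" where
  "ramp_a h k = h * (2 * real k / real a - 1)"

definition ramp_b :: "real \<Rightarrow> nat \<Rightarrow> real" where
  "ramp_b h j = h * (1 - 2 * real j / real b)"

lemma ramp_a:
  assumes "2 * \<bar>h\<bar> \<le> real a"
  shows "ramp_a h a = h" "\<bar>ramp_a h (k + 1) - ramp_a h k\<bar> \<le> 1" "\<bar>ramp_a h a + ramp_a h 1\<bar> \<le> 1"
proof -
  have "\<bar>2 * h / real a\<bar> \<le> 1" using assms a by (simp add: abs_mult)
  moreover have "ramp_a h (k + 1) - ramp_a h k = 2 * h / real a" "ramp_a h a + ramp_a h 1 = 2 * h / real a"
    using a by (auto simp: ramp_a_def field_simps)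
  ultimately show "\<bar>ramp_a h (k + 1) - ramp_a h k\<bar> \<le> 1" "\<bar>ramp_a h a + ramp_a h 1\<bar> \<le> 1" by simp_all
  show "ramp_a h a = h" using a by (simp add: ramp_a_def)
qed

text \<open>For odd \<open>b\<close> the closing condition is a sum, and it equals the common step
  \<open>2 * h / b\<close>.\<close>

lemma ramp_b:
  assumes "2 * \<bar>h\<bar> \<le> real b" "odd b"
  shows "ramp_b h 0 = h" "\<bar>ramp_b h (j + 1) - ramp_b h j\<bar> \<le> 1"
    "\<bar>ramp_b h 0 - (-1) ^ b * ramp_b h (b - 1)\<bar> \<le> 1"
proof -
  have "\<bar>2 * h / real b\<bar> \<le> 1" using assms b by (simp add: abs_mult)
  moreover have "ramp_b h (j + 1) - ramp_b h j = - (2 * h / real b)"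
    "ramp_b h 0 - (-1) ^ b * ramp_b h (b - 1) = 2 * h / real b"
    using b assms(2) by (auto simp: ramp_b_def field_simps of_nat_diff)
  ultimately show "\<bar>ramp_b h (j + 1) - ramp_b h j\<bar> \<le> 1"
    "\<bar>ramp_b h 0 - (-1) ^ b * ramp_b h (b - 1)\<bar> \<le> 1" by simp_all
  show "ramp_b h 0 = h" by (simp add: ramp_b_def)
qed

section \<open>Lower bounds from explicit dual weightings\<close>

lemma lower_bounds_odd:
  assumes G: "G \<in> carrier_mat n (n + 1)" and inv: "G * ET_W n a b = 1\<^sub>m n" and "odd b"
  shows "real (2 * min a b) \<le> inf_norm_mat G" "real a \<le> inf_norm_mat G" "real b \<le> inf_norm_mat G"
proof -
  \<comment> \<open>The largest height that both ramps allow; the common vertex has degree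
    4.\<close>
  define h where "h = real (min a b) / 2"
  have h: "2 * \<bar>h\<bar> \<le> real a" "2 * \<bar>h\<bar> \<le> real b" by (auto simp: h_def)
  have "4 * \<bar>ramp_a h a\<bar> \<le> inf_norm_mat G"
    by (rule cycle_dual_bounds(1)[OF G inv, where q = "ramp_b h"])
      (use ramp_a[OF h(1)] ramp_b[OF h(2) \<open>odd b\<close>] in auto)
  then show "real (2 * min a b) \<le> inf_norm_mat G"
    using ramp_a(1)[OF h(1)] by (simp add: h_def)
next
  obtain r where r: "a = 2 * r + 1" using odd_a by (elim oddE)
  \<comment> \<open>A tent of height \<open>a / 2\<close> at a vertex opposite to \<open>a\<close>.
    Its values 3/2 at vertex 1 and -1/2 at vertex \<open>a\<close> add up to 1, so the closing edge
    is tight; the ramp with height -1/2 continues it.\<close>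
  define p where "p k = real a / 2 - \<bar>real k - real r\<bar>" for k
  have "2 * \<bar>p r\<bar> \<le> inf_norm_mat G"
    by (rule cycle_dual_bounds(2)[OF G inv, where q = "ramp_b (-1/2)"])
      (use ramp_b[of "-1/2", OF _ \<open>odd b\<close>] a b r in \<open>auto simp: p_def add_divide_distrib\<close>)
  then show "real a \<le> inf_norm_mat G" by (simp add: p_def)
next
  obtain r where r: "b = 2 * r + 1" using \<open>odd b\<close> by (elim oddE)
  \<comment> \<open>This tent has value 1/2 at both neighbouring ends \<open>0\<close> and
    \<open>b - 1\<close>, so the closing sum is again 1.\<close>
  define q where "q j = real b / 2 - \<bar>real j - real r\<bar>" for j
  have "2 * \<bar>q r\<bar> \<le> inf_norm_mat G"
    by (rule cycle_dual_bounds(3)[OF G inv, where p = "ramp_a (1/2)"])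
      (use ramp_a[of "1/2"] a b r in \<open>auto simp: q_def add_divide_distrib\<close>)
  then show "real b \<le> inf_norm_mat G" by (simp add: q_def)
qed

text \<open>An even cycle is bipartite: constant signed weights on it are feasible at any height, so
  only the odd cycle limits the height at the common vertex, namely to \<open>a / 2\<close>.\<close>

lemma lower_bounds_even:
  assumes G: "G \<in> carrier_mat n (n + 1)" and inv: "G * ET_W n a b = 1\<^sub>m n" and "even b"
  shows "real (2 * a) \<le> inf_norm_mat G" "real (a + b) \<le> inf_norm_mat G"
proof -
  have "4 * \<bar>ramp_a (real a / 2) a\<bar> \<le> inf_norm_mat G"
    by (rule cycle_dual_bounds(1)[OF G inv, where q = "\<lambda>_. real a / 2"])
      (use ramp_a[of "real a / 2"] \<open>even b\<close> in auto)
  then show "real (2 * a) \<le> inf_norm_mat G"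
    using ramp_a(1)[of "real a / 2"] by simp
next
  obtain r where r: "b = 2 * r" using \<open>even b\<close> by (elim evenE)
  \<comment> \<open>The tent starts at the maximal height \<open>a / 2\<close> and rises by
    \<open>b / 2\<close> up to the opposite vertex \<open>r\<close>.\<close>
  define q where "q j = real (a + b) / 2 - \<bar>real j - real r\<bar>" for j
  have "2 * \<bar>q r\<bar> \<le> inf_norm_mat G"
    by (rule cycle_dual_bounds(3)[OF G inv, where p = "ramp_a (real a / 2)"])
      (use ramp_a[of "real a / 2"] b r in \<open>auto simp: q_def add_divide_distrib\<close>)
  then show "real (a + b) \<le> inf_norm_mat G" by (simp add: q_def)
qed

section \<open>Explicit rows attaining the bounds\<close>

lemma sum_cycle_le:
  fixes c :: "nat \<Rightarrow> real"
  shows "(\<And>k. k \<in> {1..a} \<Longrightarrow> \<bar>c k\<bar> \<le> x) \<Longrightarrow> (\<Sum>k\<in>{1..a}. \<bar>c k\<bar>) \<le> real a * x"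
    and "(\<And>k. k \<in> {a<..a + b} \<Longrightarrow> \<bar>c k\<bar> \<le> x) \<Longrightarrow> (\<Sum>k\<in>{a<..a + b}. \<bar>c k\<bar>) \<le> real b * x"
  using sum_bounded_above[of "{1..a}" "\<lambda>k. \<bar>c k\<bar>" x]
    sum_bounded_above[of "{a<..a + b}" "\<lambda>k. \<bar>c k\<bar>" x] by auto

text \<open>Edge weights alternating between 2 and -2 around the odd cycle cancel at every vertex
  but the common one, whose two edges both get 2.\<close>

lemma common_row_a_cycle: "row_norm_le a (real (2 * a))"
proof -
  define c :: "nat \<Rightarrow> real" where "c k = (if k < a then 2 else if k = a then -2 else 0)" for k
  have norms: "(\<Sum>k\<in>{1..a}. \<bar>c k\<bar>) \<le> real a * 2" "(\<Sum>k\<in>{a<..a + b}. \<bar>c k\<bar>) \<le> real b * 0"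
    by (rule sum_cycle_le; simp add: c_def)+
  show ?thesis
  proof (rule ex_row_of_signed_weights[where c = c])
    show "(\<Sum>k\<in>{1..a}. \<bar>c k\<bar>) + (\<Sum>k\<in>{a<..a + b}. \<bar>c k\<bar>) \<le> real (2 * a)"
      using norms by simp
  qed (use a b n in \<open>auto simp: c_def\<close>)
qed

lemma common_row_b_cycle:
  assumes "odd b"
  shows "row_norm_le a (real (2 * b))"
proof -
  define c :: "nat \<Rightarrow> real" where "c k = (if k \<le> a then 0 else 2)" for k
  have norms: "(\<Sum>k\<in>{1..a}. \<bar>c k\<bar>) \<le> real a * 0" "(\<Sum>k\<in>{a<..a + b}. \<bar>c k\<bar>) \<le> real b * 2"
    by (rule sum_cycle_le; use assms in \<open>simp add: c_def\<close>)+
  show ?thesis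
  proof (rule ex_row_of_signed_weights[where c = c])
    show "(\<Sum>k\<in>{1..a}. \<bar>c k\<bar>) + (\<Sum>k\<in>{a<..a + b}. \<bar>c k\<bar>) \<le> real (2 * b)"
      using norms by simp
  qed (use a b n assms in \<open>auto simp: c_def\<close>)
qed

text \<open>Weights alternate between 1 and -1 around the odd cycle, with 1 on both edges at
  \<open>i\<close>; they cancel elsewhere, including at \<open>a\<close>.\<close>

lemma a_cycle_row:
  assumes "1 \<le> i" "i < a"
  shows "row_norm_le i (real a)"
proof -
  define c :: "nat \<Rightarrow> real" where
    "c k = (if k < i then - ((-1) ^ i) else if k \<le> a then (-1) ^ i else 0)" for k
  have norms: "(\<Sum>k\<in>{1..a}. \<bar>c k\<bar>) \<le> real a * 1" "(\<Sum>k\<in>{a<..a + b}. \<bar>c k\<bar>) \<le> real b * 0"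
    by (rule sum_cycle_le; use assms in \<open>simp add: c_def\<close>)+
  show ?thesis
  proof (rule ex_row_of_signed_weights[where c = c])
    show "(\<Sum>k\<in>{1..a}. \<bar>c k\<bar>) + (\<Sum>k\<in>{a<..a + b}. \<bar>c k\<bar>) \<le> real a"
      using norms by simp
  qed (use a b n assms in \<open>auto simp: c_def\<close>)
qed

lemma b_cycle_row_odd:
  assumes "a < i" "i \<le> n" "odd b"
  shows "row_norm_le i (real b)"
proof -
  define c :: "nat \<Rightarrow> real" where
    "c k = (if k \<le> a then 0 else if k \<le> i then (-1) ^ i else - ((-1) ^ i))" for k
  have norms: "(\<Sum>k\<in>{1..a}. \<bar>c k\<bar>) \<le> real a * 0" "(\<Sum>k\<in>{a<..a + b}. \<bar>c k\<bar>) \<le> real b * 1"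
    by (rule sum_cycle_le; use assms in \<open>simp add: c_def\<close>)+
  show ?thesis
  proof (rule ex_row_of_signed_weights[where c = c])
    show "(\<Sum>k\<in>{1..a}. \<bar>c k\<bar>) + (\<Sum>k\<in>{a<..a + b}. \<bar>c k\<bar>) \<le> real b"
      using norms by simp
  qed (use a b n assms in \<open>auto simp: c_def\<close>)
qed

text \<open>The demand 2 at \<open>i\<close> cannot be met within the bipartite cycle. Weights of
  modulus 2 carry it along the shorter path to \<open>a\<close>, of at most \<open>b / 2\<close>
  edges, and weights of modulus 1 around the odd cycle absorb it there.\<close>

lemma b_cycle_row_even:
  assumes "a < i" "i \<le> n" "even b"
  shows "row_norm_le i (real (a + b))"
proof (cases "2 * (i - a) \<le> b")
  case True
  \<comment> \<open>The path consists of edges \<open>a + 1\<close> to \<open>i\<close>.\<close>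
  define c :: "nat \<Rightarrow> real" where
    "c k = (if k < a then - ((-1) ^ i) else if k = a then (-1) ^ i
            else if k \<le> i then 2 * (-1) ^ i else 0)" for k
  have "(\<Sum>k\<in>{a<..a + b}. \<bar>c k\<bar>) = (\<Sum>k\<in>{a<..i}. 2)"
    by (rule sum.mono_neutral_cong_right) (use assms n in \<open>auto simp: c_def abs_mult\<close>)
  then have norms: "(\<Sum>k\<in>{a<..a + b}. \<bar>c k\<bar>) \<le> real b" "(\<Sum>k\<in>{1..a}. \<bar>c k\<bar>) \<le> real a * 1"
    using True by (simp, intro sum_cycle_le) (simp add: c_def)
  show ?thesis
  proof (rule ex_row_of_signed_weights[where c = c])
    show "(\<Sum>k\<in>{1..a}. \<bar>c k\<bar>) + (\<Sum>k\<in>{a<..a + b}. \<bar>c k\<bar>) \<le> real (a + b)"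
      using norms by simp
  qed (use a b n assms in \<open>auto simp: c_def\<close>)
next
  case False
  \<comment> \<open>The path consists of edges \<open>i + 1\<close> to \<open>a + b\<close>.\<close>
  define c :: "nat \<Rightarrow> real" where
    "c k = (if k < a then - ((-1) ^ i) else if k = a then (-1) ^ i
            else if k \<le> i then 0 else - 2 * (-1) ^ i)" for k
  have "(\<Sum>k\<in>{a<..a + b}. \<bar>c k\<bar>) = (\<Sum>k\<in>{i<..a + b}. 2)"
    by (rule sum.mono_neutral_cong_right) (use assms n in \<open>auto simp: c_def abs_mult\<close>)
  then have norms: "(\<Sum>k\<in>{a<..a + b}. \<bar>c k\<bar>) \<le> real b" "(\<Sum>k\<in>{1..a}. \<bar>c k\<bar>) \<le> real a * 1"
    using False assms n by (simp, intro sum_cycle_le) (simp add: c_def)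
  show ?thesis
  proof (rule ex_row_of_signed_weights[where c = c])
    show "(\<Sum>k\<in>{1..a}. \<bar>c k\<bar>) + (\<Sum>k\<in>{a<..a + b}. \<bar>c k\<bar>) \<le> real (a + b)"
      using norms by simp
  qed (use a b n assms in \<open>auto simp: c_def\<close>)
qed

section \<open>Matching the two bounds\<close>

lemma row_norm_le_mono: "row_norm_le i \<mu> \<Longrightarrow> \<mu> \<le> \<nu> \<Longrightarrow> row_norm_le i \<nu>"
  unfolding row_norm_le_def by (meson order_trans)

text \<open>The left inverse assembled from the rows serves twice: it identifies inner inverses with
  left inverses, and it attains the lower bound.\<close>

lemma min_norm_inner_inverse:
  assumes rows: "\<And>i. i \<in> {1..n} \<Longrightarrow> row_norm_le i \<mu>"
    and lower: "\<And>G. G \<in> carrier_mat n (n + 1) \<Longrightarrow> G * ET_W n a b = 1\<^sub>m n \<Longrightarrow> \<mu> \<le> inf_norm_mat G"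
  shows "(\<exists>G \<in> inner_inverses (ET_W n a b). inf_norm_mat G = \<mu>) \<and>
    (\<forall>G \<in> inner_inverses (ET_W n a b). \<mu> \<le> inf_norm_mat G)"
proof -
  obtain G where G: "G \<in> carrier_mat n (n + 1)" "G * ET_W n a b = 1\<^sub>m n" "inf_norm_mat G \<le> \<mu>"
    using ex_left_inverse_of_rows[OF degree_pos _ _ rows[unfolded row_norm_le_def]] a n unfolding ET_W_def by auto
  have W: "ET_W n a b \<in> carrier_mat (n + 1) n"
    unfolding ET_W_def weighted_incidence_mat_eq[OF degree_pos] by simp
  show ?thesis
    unfolding inner_inverses_eq_left_inverses[OF W G(1,2)]
    using G lower[OF G(1,2)] lower by force
qed

end

theorem theorem4p1:
  fixes a b n :: nat
  assumes "a > 2" and "b > 2" and "odd a" and "n = a + b - 1"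
  shows "let W = ET_W n a b;
             \<mu> = real (if odd b \<and> a > 2 * b then a
                       else if odd b \<and> a \<le> 2 * b \<and> b \<le> 2 * a then 2 * min a b
                       else if odd b \<and> b > 2 * a then b
                       else max (2 * a) (a + b))
         in (\<exists>G \<in> inner_inverses W. inf_norm_mat G = \<mu>) \<and>
            (\<forall>G \<in> inner_inverses W. \<mu> \<le> inf_norm_mat G)"
proof -
  interpret ET a b n using assms by unfold_locales
  \<comment> \<open>For odd \<open>b\<close> the three cases are the maximum of the bounds
    \<open>2 * min a b\<close>, \<open>a\<close> and \<open>b\<close>.\<close>
  define m where "m = (if odd b then max (2 * min a b) (max a b) else max (2 * a) (a + b))"
  have m: "(if odd b \<and> a > 2 * b then a
            else if odd b \<and> a \<le> 2 * b \<and> b \<le> 2 * a then 2 * min a b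
            else if odd b \<and> b > 2 * a then b
            else max (2 * a) (a + b)) = m"
    by (auto simp: m_def)
  have rows: "row_norm_le i (real m)" if i: "i \<in> {1..n}" for i
  proof -
    \<comment> \<open>For the common vertex the row is supported on the shorter odd cycle.\<close>
    consider "i < a" | "i = a" "even b \<or> a \<le> b" | "i = a" "odd b" "b < a"
      | "i > a" "odd b" | "i > a" "even b"
      by linarith
    then show ?thesis
    proof cases
      case 1
      then show ?thesis using i by (intro row_norm_le_mono[OF a_cycle_row]) (auto simp: m_def)
    next
      case 2
      then show ?thesis by (auto intro!: row_norm_le_mono[OF common_row_a_cycle] simp: m_def)
    next
      case 3
      then show ?thesis by (auto intro!: row_norm_le_mono[OF common_row_b_cycle] simp: m_def)
    next
      case 4
      then show ?thesis using i by (intro row_norm_le_mono[OF b_cycle_row_odd]) (auto simp: m_def)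
    next
      case 5
      then show ?thesis using i by (intro row_norm_le_mono[OF b_cycle_row_even]) (auto simp: m_def)
    qed
  qed
  have lower: "real m \<le> inf_norm_mat G"
    if G: "G \<in> carrier_mat n (n + 1)" "G * ET_W n a b = 1\<^sub>m n" for G
    using lower_bounds_odd[OF G] lower_bounds_even[OF G] by (auto simp: m_def)
  show ?thesis
    unfolding m Let_def by (rule min_norm_inner_inverse[OF rows lower])
qed

end
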